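(* Let $\mathcal A$ be a finite set of $m\ge2$ alternatives, $0<\varphi<1$, $n\ge1$, and consider Mallows' model with dispersion $\varphi$ and $n$ i.i.d. rankings. For any $a\in\mathcal A$ and any $0<\alpha<1$, the following test is a level-$\alpha$ UMP test for $H_0=L_{\text{others}\succ a}$ vs. $H_1=L_{a\succ\text{others}}$: for every $n$-profile $P_n$, $$f_{\alpha,a}(P_n)=\begin{cases}1&\text{if }w_{P_n}(a\succ\text{others})>K_\alpha\\ 0&\text{if }w_{P_n}(a\succ\text{others})<K_\alpha\\ \Gamma_\alpha&\text{if }w_{P_n}(a\succ\text{others})=K_\alpha,\end{cases}$$ where $K_\alpha\in\mathbb R$ and $\Gamma_\alpha\in[0,1]$ are chosen such that the size of $f_{\alpha,a}$ is $\alpha$.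
   Context: $\mathcal L(\mathcal A)$ is the set of all linear orders (rankings) over $\mathcal A$; $b\succ_V c$ means $b$ is preferred to $c$ in $V$. $L_{a\succ\text{others}}$ is the set of rankings in which $a$ is ranked at the top; $L_{\text{others}\succ a}$ is the set of rankings in which $a$ is ranked at the bottom. The Kendall-tau distance $\mathrm{KT}(V,W)$ is the number of unordered pairs of alternatives on which $V$ and $W$ disagree. Mallows' model with fixed dispersion $\varphi$: sample space $\mathcal L(\mathcal A)^n$, parameter space $\mathcal L(\mathcal A)$; given parameter $W$, the $n$ rankings are i.i.d. with $\pi_W(V)=\frac1Z\varphi^{\mathrm{KT}(V,W)}$, $Z$ the normalization factor. An $n$-profile $P$ is an element of $\mathcal L(\mathcal A)^n$; $P(b\succ c)$ is the number of votes in $P$ in which $b$ is preferred to $c$; $w_P(b\succ c)=P(b\succ c)-P(c\succ b)$; $w_P(a\succ\text{others})=\sum_{b\ne a}w_P(a\succ b)$. Testing: for disjoint sets of parameters $H_0,H_1$, a (randomized) test is a function $f$ from the sample space to $[0,1]$ ($f(P)$ is the probability of rejecting $H_0$). $\mathrm{Size}(f,h_0)=E_{P\sim\pi_{h_0}}f(P)$, $\mathrm{Size}(f)=\sup_{h_0\in H_0}\mathrm{Size}(f,h_0)$, and $\mathrm{Power}(f,h_1)=E_{P\sim\pi_{h_1}}f(P)$ for $h_1\in H_1$. A level-$\alpha$ uniformly most powerful (UMP) test for $H_0$ vs. $H_1$ is a test $f$ with $\mathrm{Size}(f)=\alpha$ such that for every $h_1\in H_1$ and every test $g$ with $\mathrm{Size}(g)\le\alpha$,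 $\mathrm{Power}(f,h_1)\ge\mathrm{Power}(g,h_1)$. *)

theory Defs
  imports "HOL-Probability.Probability"
begin

text \<open>
  A ranking is a reflexive linear order \<open>V\<close> on the set \<open>A\<close> of alternatives, where
  \<open>(b, c) \<in> V\<close> means that \<open>b\<close> is ranked at least as high as \<open>c\<close>;
  the strict part \<open>prefers V b c\<close> is \<open>b \<succ>\<^sub>V c\<close>.
\<close>

definition rankings :: "'a set \<Rightarrow> 'a rel set" where
  "rankings A = {V. linear_order_on A V}"

definition prefers :: "'a rel \<Rightarrow> 'a \<Rightarrow> 'a \<Rightarrow> bool" where
  "prefers V b c \<longleftrightarrow> (b, c) \<in> V \<and> b \<noteq> c"

definition top_rankings :: "'a set \<Rightarrow> 'a \<Rightarrow> 'a rel set" where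
  "top_rankings A a = {V \<in> rankings A. \<forall>b\<in>A - {a}. prefers V a b}"

definition bottom_rankings :: "'a set \<Rightarrow> 'a \<Rightarrow> 'a rel set" where
  "bottom_rankings A a = {V \<in> rankings A. \<forall>b\<in>A - {a}. prefers V b a}"

definition kendall_tau :: "'a rel \<Rightarrow> 'a rel \<Rightarrow> nat" where
  "kendall_tau V W = card {{b, c} | b c. prefers V b c \<and> prefers W c b}"

definition profiles :: "'a set \<Rightarrow> nat \<Rightarrow> 'a rel list set" where
  "profiles A n = {P. length P = n \<and> set P \<subseteq> rankings A}"

definition votes :: "'a rel list \<Rightarrow> 'a \<Rightarrow> 'a \<Rightarrow> nat" where
  "votes P b c = length (filter (\<lambda>V. prefers V b c) P)"

definition margin :: "'a rel list \<Rightarrow> 'a \<Rightarrow> 'a \<Rightarrow> int" where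
  "margin P b c = int (votes P b c) - int (votes P c b)"

definition margin_others :: "'a set \<Rightarrow> 'a rel list \<Rightarrow> 'a \<Rightarrow> int" where
  "margin_others A P a = (\<Sum>b\<in>A - {a}. margin P a b)"

definition mallows_Z :: "'a set \<Rightarrow> real \<Rightarrow> 'a rel \<Rightarrow> real" where
  "mallows_Z A \<phi> W = (\<Sum>V\<in>rankings A. \<phi> ^ kendall_tau V W)"

text \<open>
  \<open>embed_pmf\<close> is only meaningful if its argument is a probability mass function; lemma
  \<open>pmf_mallows\<close> below shows that this is the case for finite \<open>A\<close> and positive \<open>\<phi>\<close>.
\<close>

definition mallows :: "'a set \<Rightarrow> real \<Rightarrow> 'a rel \<Rightarrow> 'a rel pmf" where
  "mallows A \<phi> W =
     embed_pmf (\<lambda>V. if V \<in> rankings A then \<phi> ^ kendall_tau V W / mallows_Z A \<phi> W else 0)"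

definition mallows_profile :: "'a set \<Rightarrow> real \<Rightarrow> nat \<Rightarrow> 'a rel \<Rightarrow> 'a rel list pmf" where
  "mallows_profile A \<phi> n W = replicate_pmf n (mallows A \<phi> W)"

lemma finite_rankings: "finite A \<Longrightarrow> finite (rankings A)"
  by (rule finite_subset[of _ "Pow (A \<times> A)"])
     (auto simp: rankings_def order_on_defs)

lemma rankings_nonempty: "rankings A \<noteq> {}"
  using well_order_on[of A] by (auto simp: rankings_def well_order_on_def)

lemma mallows_Z_pos:
  assumes "finite A" "\<phi> > 0"
  shows "mallows_Z A \<phi> W > 0"
  unfolding mallows_Z_def
  using assms by (intro sum_pos finite_rankings rankings_nonempty) auto

lemma pmf_mallows:
  assumes "finite A" "\<phi> > 0"
  shows "pmf (mallows A \<phi> W) V =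
           (if V \<in> rankings A then \<phi> ^ kendall_tau V W / mallows_Z A \<phi> W else 0)"
  unfolding mallows_def
proof (rule pmf_embed_pmf)
  let ?f = "\<lambda>V. if V \<in> rankings A then \<phi> ^ kendall_tau V W / mallows_Z A \<phi> W else 0"
  note Z = mallows_Z_pos[OF assms, of W]
  show nonneg: "0 \<le> ?f V" for V
    using assms Z by simp
  have "(\<integral>\<^sup>+V. ennreal (?f V) \<partial>count_space UNIV)
          = (\<Sum>V\<in>rankings A. ennreal (?f V))"
    by (rule nn_integral_count_space'[OF finite_rankings[OF assms(1)]]) auto
  also have "\<dots> = ennreal (\<Sum>V\<in>rankings A. ?f V)"
    by (rule sum_ennreal) (rule nonneg)
  also have "(\<Sum>V\<in>rankings A. ?f V) = 1"
    using Z by (simp add: sum_divide_distrib[symmetric] mallows_Z_def)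
  finally show "(\<integral>\<^sup>+V. ennreal (?f V) \<partial>count_space UNIV) = 1"
    by simp
qed

lemma set_pmf_mallows:
  assumes "finite A" "\<phi> > 0"
  shows "set_pmf (mallows A \<phi> W) = rankings A"
  using assms mallows_Z_pos[OF assms, of W] by (auto simp: set_pmf_eq pmf_mallows)

lemma set_pmf_mallows_profile:
  assumes "finite A" "\<phi> > 0"
  shows "set_pmf (mallows_profile A \<phi> n W) = profiles A n"
  using set_pmf_mallows[OF assms, of W]
  by (auto simp: mallows_profile_def set_replicate_pmf profiles_def)

text \<open>
  A statistical model is given by a sample space \<open>S\<close> and a family \<open>\<pi>\<close> of distributions
  supported on \<open>S\<close>, indexed by the parameters. The supremum in \<open>test_size\<close> is that of
  real numbers, so it is only meaningful for a nonempty \<open>H0\<close>.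
\<close>

definition is_test :: "'x set \<Rightarrow> ('x \<Rightarrow> real) \<Rightarrow> bool" where
  "is_test S f \<longleftrightarrow> (\<forall>x\<in>S. 0 \<le> f x \<and> f x \<le> 1)"

definition size_at :: "('h \<Rightarrow> 'x pmf) \<Rightarrow> ('x \<Rightarrow> real) \<Rightarrow> 'h \<Rightarrow> real" where
  "size_at \<pi> f h0 = measure_pmf.expectation (\<pi> h0) f"

definition test_size :: "('h \<Rightarrow> 'x pmf) \<Rightarrow> 'h set \<Rightarrow> ('x \<Rightarrow> real) \<Rightarrow> real" where
  "test_size \<pi> H0 f = (SUP h0\<in>H0. size_at \<pi> f h0)"

definition power_at :: "('h \<Rightarrow> 'x pmf) \<Rightarrow> ('x \<Rightarrow> real) \<Rightarrow> 'h \<Rightarrow> real" where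
  "power_at \<pi> f h1 = measure_pmf.expectation (\<pi> h1) f"

definition is_UMP ::
  "'x set \<Rightarrow> ('h \<Rightarrow> 'x pmf) \<Rightarrow> 'h set \<Rightarrow> 'h set \<Rightarrow> real \<Rightarrow> ('x \<Rightarrow> real) \<Rightarrow> bool" where
  "is_UMP S \<pi> H0 H1 \<alpha> f \<longleftrightarrow>
     H0 \<inter> H1 = {} \<and> is_test S f \<and> test_size \<pi> H0 f = \<alpha> \<and>
     (\<forall>h1\<in>H1. \<forall>g. is_test S g \<and> test_size \<pi> H0 g \<le> \<alpha> \<longrightarrow> power_at \<pi> f h1 \<ge> power_at \<pi> g h1)"

definition threshold_test :: "'a set \<Rightarrow> 'a \<Rightarrow> real \<Rightarrow> real \<Rightarrow> 'a rel list \<Rightarrow> real" where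
  "threshold_test A a K \<Gamma> P =
     (if real_of_int (margin_others A P a) > K then 1
      else if real_of_int (margin_others A P a) < K then 0
      else \<Gamma>)"

end

theory Submission
  imports Defs
begin

text \<open>
  Let \<open>W\<close> rank \<open>a\<close> first, and let \<open>B\<close> be \<open>W\<close> with \<open>a\<close> moved to the last place. A vote \<open>V\<close>
  disagrees with \<open>W\<close> and with \<open>B\<close> on the same pairs that avoid \<open>a\<close>; of the pairs \<open>{a, b}\<close>, it
  disagrees with \<open>W\<close> on those where it prefers \<open>b\<close>, and with \<open>B\<close> on those where it prefers \<open>a\<close>.
  Hence \<open>KT(V, B) - KT(V, W)\<close> is the contribution of \<open>V\<close> to the margin of \<open>a\<close> over the others
  (lemma \<open>kendall_tau_move_to_bottom\<close>). Taking products over the votes, the likelihood ratio of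
  \<open>W\<close> to \<open>B\<close> at a profile is a positive constant times \<open>\<phi>\<close> to the power of minus this margin
  (lemma \<open>likelihood_ratio\<close>), which strictly increases with the margin because \<open>\<phi> < 1\<close>. The
  threshold test is therefore a likelihood ratio test, and by the Neyman--Pearson lemma
  (\<open>neyman_pearson\<close>) no test whose size at \<open>B\<close> is at most that of the threshold test has more
  power at \<open>W\<close>.

  The ranking \<open>B\<close> depends on \<open>W\<close>, so one more idea is needed to pass from the size at \<open>B\<close> to the
  size over all of \<open>H\<^sub>0\<close>: any two rankings with \<open>a\<close> at the bottom are carried into each other by
  a permutation of the alternatives that fixes \<open>a\<close>. Mallows' model is equivariant under such
  permutations and the margin of \<open>a\<close> is invariant, so the threshold test has the same size at
  every point of \<open>H\<^sub>0\<close> (lemma \<open>size_at_bottom_rankings_const\<close>): each of them is least favourable.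
  A competitor of level \<open>\<alpha>\<close> thus has size at most \<open>\<alpha>\<close> at \<open>B\<close>, where the threshold test has size
  exactly \<open>\<alpha>\<close>.

  That suitable \<open>K\<close> and \<open>\<Gamma>\<close> exist is then a statement about a single distribution
  (lemma \<open>threshold_attains_level\<close>).
\<close>

section \<open>Threshold tests and the Neyman--Pearson lemma\<close>

text \<open>
  The cutoff \<open>K\<close> is an upper \<open>\<alpha>\<close>-quantile: the largest value that the statistic reaches or
  exceeds with probability more than \<open>\<alpha>\<close>. It is strictly exceeded with probability at most
  \<open>\<alpha>\<close>, and randomizing on the atom at \<open>K\<close> makes up the difference.
\<close>

lemma threshold_attains_level:
  fixes p :: "'x pmf" and T :: "'x \<Rightarrow> real" and \<alpha> :: real
  assumes fin: "finite (set_pmf p)" and "0 < \<alpha>" "\<alpha> < 1"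
  shows "\<exists>K \<Gamma>. 0 \<le> \<Gamma> \<and> \<Gamma> \<le> 1 \<and>
    measure_pmf.expectation p (\<lambda>x. if T x > K then 1 else if T x < K then 0 else \<Gamma>) = \<alpha>"
proof -
  let ?P = "\<lambda>R. measure_pmf.prob p {x. R (T x)}"
  define B where "B = {t \<in> T ` set_pmf p. \<alpha> < ?P (\<lambda>u. t \<le> u)}"
  have finB: "finite B" using fin by (simp add: B_def)
  have "Min (T ` set_pmf p) \<in> B"
  proof -
    have "?P (\<lambda>u. Min (T ` set_pmf p) \<le> u) = 1"
      using fin by (auto simp: measure_pmf.prob_eq_1 AE_measure_pmf_iff)
    then show ?thesis
      using fin assms Min_in[of "T ` set_pmf p"] by (auto simp: B_def set_pmf_not_empty)
  qed
  then have neB: "B \<noteq> {}" by blast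
  define K where "K = Max B"
  have KB: "K \<in> B" using Max_in[OF finB neB] by (simp add: K_def)
  then have ge: "\<alpha> < ?P (\<lambda>u. K \<le> u)" by (simp add: B_def)
  have gt: "?P (\<lambda>u. K < u) \<le> \<alpha>"
  proof (cases "\<exists>x\<in>set_pmf p. K < T x")
    case False
    then have "?P (\<lambda>u. K < u) = 0"
      by (auto simp: measure_pmf.prob_eq_0 AE_measure_pmf_iff)
    then show ?thesis using assms by simp
  next
    case True
    \<comment> \<open>On the support, exceeding \<open>K\<close> means reaching the next value of the statistic.\<close>
    define C where "C = {t \<in> T ` set_pmf p. K < t}"
    have C: "finite C" "C \<noteq> {}" using fin True by (auto simp: C_def)
    define t where "t = Min C"
    have t: "t \<in> C" using Min_in[OF C] by (simp add: t_def)
    then have "t \<notin> B" using Max_ge[OF finB, of t] by (auto simp: C_def K_def)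
    then have "?P (\<lambda>u. t \<le> u) \<le> \<alpha>" using t by (auto simp: B_def C_def)
    moreover have "?P (\<lambda>u. K < u) = ?P (\<lambda>u. t \<le> u)"
    proof (rule measure_pmf.finite_measure_eq_AE)
      have "K < T x \<longleftrightarrow> t \<le> T x" if "x \<in> set_pmf p" for x
        using t Min_le[OF C(1), of "T x"] that by (auto simp: C_def t_def)
      then show "AE x in measure_pmf p. x \<in> {x. K < T x} \<longleftrightarrow> x \<in> {x. t \<le> T x}"
        by (auto simp: AE_measure_pmf_iff)
    qed auto
    ultimately show ?thesis by simp
  qed
  have split: "?P (\<lambda>u. K \<le> u) = ?P (\<lambda>u. K < u) + ?P (\<lambda>u. u = K)"
    by (subst measure_pmf.finite_measure_Union[symmetric]) (auto intro: arg_cong[where f = "measure p"])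
  define \<Gamma> where "\<Gamma> = (\<alpha> - ?P (\<lambda>u. K < u)) / ?P (\<lambda>u. u = K)"
  have pos: "?P (\<lambda>u. u = K) > 0" using ge gt split by linarith
  have \<Gamma>01: "0 \<le> \<Gamma>" "\<Gamma> \<le> 1"
    using pos ge gt split by (auto simp: \<Gamma>_def field_simps)
  have "measure_pmf.expectation p (\<lambda>x. if T x > K then 1 else if T x < K then 0 else \<Gamma>)
      = measure_pmf.expectation p (\<lambda>x. indicator {x. K < T x} x + \<Gamma> * indicator {x. T x = K} x)"
    by (rule Bochner_Integration.integral_cong) (auto simp: indicator_def)
  also have "\<dots> = ?P (\<lambda>u. K < u) + \<Gamma> * ?P (\<lambda>u. u = K)"
    using fin by (subst Bochner_Integration.integral_add) (auto intro: integrable_measure_pmf_finite)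
  also have "\<dots> = \<alpha>" using pos by (simp add: \<Gamma>_def)
  finally show ?thesis using \<Gamma>01 by blast
qed

text \<open>
  Where \<open>q - k p\<close> is nonzero, the test \<open>f\<close> is \<open>1\<close> or \<open>0\<close> according to its sign, so
  \<open>(f - g) (q - k p)\<close> is pointwise nonnegative. Summing, the gain in power is at least \<open>k\<close> times
  the difference of the sizes.
\<close>

lemma neyman_pearson:
  fixes p q :: "'x pmf"
  assumes "finite S" "set_pmf p \<subseteq> S" "set_pmf q \<subseteq> S"
    and "is_test S g" and "0 \<le> k"
    and rej: "\<And>x. x \<in> S \<Longrightarrow> k * pmf p x < pmf q x \<Longrightarrow> f x = 1"
    and acc: "\<And>x. x \<in> S \<Longrightarrow> pmf q x < k * pmf p x \<Longrightarrow> f x = 0"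
    and level: "measure_pmf.expectation p g \<le> measure_pmf.expectation p f"
  shows "measure_pmf.expectation q g \<le> measure_pmf.expectation q f"
proof -
  have E: "measure_pmf.expectation r h = (\<Sum>x\<in>S. h x * pmf r x)"
    if "set_pmf r \<subseteq> S" for r :: "'x pmf" and h
    using assms(1) that by (intro integral_measure_pmf_real) auto
  have "0 \<le> (\<Sum>x\<in>S. (f x - g x) * (pmf q x - k * pmf p x))"
  proof (rule sum_nonneg)
    fix x assume x: "x \<in> S"
    then have g: "0 \<le> g x" "g x \<le> 1" using assms(4) by (auto simp: is_test_def)
    consider "k * pmf p x < pmf q x" | "pmf q x < k * pmf p x" | "pmf q x = k * pmf p x"
      by linarith
    then show "0 \<le> (f x - g x) * (pmf q x - k * pmf p x)"
    proof cases
      case 1 then show ?thesis using rej[OF x] g by simp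
    next
      case 2 then show ?thesis using acc[OF x] g by (simp add: mult_nonneg_nonpos mult_nonpos_nonpos)
    qed simp
  qed
  also have "\<dots> = (measure_pmf.expectation q f - measure_pmf.expectation q g)
      - k * (measure_pmf.expectation p f - measure_pmf.expectation p g)"
    using assms(2,3) by (simp add: E algebra_simps sum.distrib sum_subtractf sum_distrib_left)
  finally show ?thesis
    using mult_nonneg_nonneg[OF \<open>0 \<le> k\<close>, of "measure_pmf.expectation p f - measure_pmf.expectation p g"]
      level by linarith
qed

section \<open>Product distributions\<close>

lemma replicate_pmf_Suc_pair:
  "replicate_pmf (Suc n) p = map_pmf (\<lambda>(x, xs). x # xs) (pair_pmf p (replicate_pmf n p))"
  by (simp add: pair_pmf_def map_bind_pmf)

text \<open>
  Independence: the likelihood of a profile is the product of the likelihoods of its votes.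
\<close>

lemma pmf_replicate_pmf:
  "pmf (replicate_pmf (length xs) p) xs = prod_list (map (pmf p) xs)"
proof (induction xs)
  case (Cons x xs)
  have inj: "inj (\<lambda>(y, ys). y # ys)" by (auto intro: injI)
  show ?case
    using pmf_map_inj'[OF inj, of "pair_pmf p (replicate_pmf (length xs) p)" "(x, xs)"] Cons
    by (simp add: replicate_pmf_Suc_pair pmf_pair del: replicate_pmf.simps)
qed simp

lemma map_replicate_pmf:
  "map_pmf (map h) (replicate_pmf n p) = replicate_pmf n (map_pmf h p)"
proof (induction n)
  case (Suc n)
  show ?case
    by (simp add: Suc[symmetric] map_bind_pmf bind_map_pmf)
qed simp

section \<open>Relabelling the alternatives\<close>

lemma rankings_iff:
  "V \<in> rankings A \<longleftrightarrow> V \<subseteq> A \<times> A \<and> (\<forall>x\<in>A. \<forall>y\<in>A. (x, y) \<in> V \<or> (y, x) \<in> V)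
     \<and> trans V \<and> antisym V"
  by (auto simp: rankings_def order_on_defs refl_on_def total_on_def) metis

definition relabel :: "('a \<Rightarrow> 'a) \<Rightarrow> 'a rel \<Rightarrow> 'a rel" where
  "relabel \<sigma> V = map_prod \<sigma> \<sigma> ` V"

lemma in_relabel_iff:
  assumes "inj_on \<sigma> A" "V \<subseteq> A \<times> A" "x \<in> A" "y \<in> A"
  shows "(\<sigma> x, \<sigma> y) \<in> relabel \<sigma> V \<longleftrightarrow> (x, y) \<in> V"
proof
  assume "(\<sigma> x, \<sigma> y) \<in> relabel \<sigma> V"
  then obtain u v where uv: "(u, v) \<in> V" "\<sigma> x = \<sigma> u" "\<sigma> y = \<sigma> v"
    by (auto simp: relabel_def)
  moreover have "u \<in> A" "v \<in> A" using uv(1) assms(2) by auto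
  ultimately show "(x, y) \<in> V" using assms by (simp add: inj_on_eq_iff)
qed (force simp: relabel_def)

lemma prefers_relabel_iff:
  assumes "inj_on \<sigma> A" "V \<subseteq> A \<times> A" "x \<in> A" "y \<in> A"
  shows "prefers (relabel \<sigma> V) (\<sigma> x) (\<sigma> y) \<longleftrightarrow> prefers V x y"
  using in_relabel_iff[OF assms] assms by (auto simp: prefers_def inj_on_def)

lemma relabel_subset: "bij_betw \<sigma> A A \<Longrightarrow> V \<subseteq> A \<times> A \<Longrightarrow> relabel \<sigma> V \<subseteq> A \<times> A"
  by (auto simp: relabel_def bij_betw_def)

lemma relabel_rankings:
  assumes \<sigma>: "bij_betw \<sigma> A A" and V: "V \<in> rankings A"
  shows "relabel \<sigma> V \<in> rankings A"
proof -
  have inj: "inj_on \<sigma> A" and im: "A = \<sigma> ` A" using \<sigma> by (auto simp: bij_betw_def)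
  have sub: "V \<subseteq> A \<times> A" using V by (simp add: rankings_iff)
  note sub' = relabel_subset[OF \<sigma> sub] and iff = in_relabel_iff[OF inj sub]
  have "\<forall>x\<in>\<sigma> ` A. \<forall>y\<in>\<sigma> ` A. (x, y) \<in> relabel \<sigma> V \<or> (y, x) \<in> relabel \<sigma> V"
    using V by (auto simp: iff rankings_iff)
  moreover have "\<forall>x\<in>\<sigma> ` A. \<forall>y\<in>\<sigma> ` A. \<forall>z\<in>\<sigma> ` A.
      (x, y) \<in> relabel \<sigma> V \<longrightarrow> (y, z) \<in> relabel \<sigma> V \<longrightarrow> (x, z) \<in> relabel \<sigma> V"
    using V by (auto simp: iff rankings_iff dest: transD)
  moreover have "\<forall>x\<in>\<sigma> ` A. \<forall>y\<in>\<sigma> ` A. (x, y) \<in> relabel \<sigma> V \<longrightarrow> (y, x) \<in> relabel \<sigma> V \<longrightarrow> x = y"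
    using V by (auto simp: iff rankings_iff dest: antisymD)
  ultimately show ?thesis
    unfolding rankings_iff im[symmetric] using sub' 
    by (intro conjI transI antisymI) blast+
qed

lemma relabel_inj_on:
  assumes "bij_betw \<sigma> A A"
  shows "inj_on (relabel \<sigma>) (rankings A)"
proof -
  have "inj_on (map_prod \<sigma> \<sigma>) (A \<times> A)"
    using assms by (auto simp: bij_betw_def inj_on_def)
  then have "inj_on (relabel \<sigma>) (Pow (A \<times> A))"
    unfolding relabel_def by (rule inj_on_image_Pow)
  then show ?thesis by (rule inj_on_subset) (auto simp: rankings_iff)
qed

lemma relabel_image_rankings:
  assumes "bij_betw \<sigma> A A" "finite A"
  shows "relabel \<sigma> ` rankings A = rankings A"
  using relabel_rankings[OF assms(1)]
  by (intro endo_inj_surj finite_rankings relabel_inj_on assms) auto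

text \<open>
  The relabelling acts injectively on the unordered pairs of alternatives and carries the
  disagreements of \<open>V\<close> and \<open>W\<close> to those of the relabelled rankings.
\<close>

lemma kendall_tau_relabel:
  assumes \<sigma>: "bij_betw \<sigma> A A" and V: "V \<subseteq> A \<times> A" and W: "W \<subseteq> A \<times> A"
  shows "kendall_tau (relabel \<sigma> V) (relabel \<sigma> W) = kendall_tau V W"
proof -
  let ?D = "\<lambda>V W. {{b, c} | b c. prefers V b c \<and> prefers W c b}"
  have inj: "inj_on \<sigma> A" and im: "A = \<sigma> ` A" using \<sigma> by (auto simp: bij_betw_def)
  note p = prefers_relabel_iff[OF inj V] prefers_relabel_iff[OF inj W]
  have "?D (relabel \<sigma> V) (relabel \<sigma> W) = (`) \<sigma> ` ?D V W"
  proof (intro equalityI subsetI)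
    fix X assume "X \<in> ?D (relabel \<sigma> V) (relabel \<sigma> W)"
    then obtain b c where X: "X = {b, c}" and bc: "prefers (relabel \<sigma> V) b c" "prefers (relabel \<sigma> W) c b"
      by blast
    have "b \<in> \<sigma> ` A" "c \<in> \<sigma> ` A"
      using bc(1) relabel_subset[OF \<sigma> V] im by (auto simp: prefers_def)
    then obtain b' c' where "b' \<in> A" "c' \<in> A" "b = \<sigma> b'" "c = \<sigma> c'" by blast
    then show "X \<in> (`) \<sigma> ` ?D V W"
      using X bc p by (auto intro!: image_eqI[of _ _ "{b', c'}"])
  next
    fix X assume "X \<in> (`) \<sigma> ` ?D V W"
    then obtain b c where X: "X = {\<sigma> b, \<sigma> c}" and bc: "prefers V b c" "prefers W c b"
      by auto
    then have "b \<in> A" "c \<in> A" using V by (auto simp: prefers_def)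
    then show "X \<in> ?D (relabel \<sigma> V) (relabel \<sigma> W)"
      using X bc p by blast
  qed
  moreover have "inj_on ((`) \<sigma>) (?D V W)"
    using V by (intro inj_on_subset[OF inj_on_image_Pow[OF inj]]) (auto simp: prefers_def)
  ultimately show ?thesis
    by (simp add: kendall_tau_def card_image)
qed

text \<open>
  Equivariance of Mallows' model: relabelling permutes the rankings and preserves the distance to
  the correspondingly relabelled centre, hence also the normalization factor.
\<close>

lemma mallows_relabel:
  assumes \<sigma>: "bij_betw \<sigma> A A" and A: "finite A" and \<phi>: "0 < \<phi>" and W: "W \<in> rankings A"
  shows "map_pmf (relabel \<sigma>) (mallows A \<phi> W) = mallows A \<phi> (relabel \<sigma> W)"
proof (rule pmf_eqI)
  fix V'
  have KT: "kendall_tau (relabel \<sigma> V) (relabel \<sigma> W) = kendall_tau V W" if "V \<in> rankings A" for V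
    using that W by (intro kendall_tau_relabel[OF \<sigma>]) (auto simp: rankings_iff)
  have "mallows_Z A \<phi> (relabel \<sigma> W)
      = (\<Sum>V\<in>relabel \<sigma> ` rankings A. \<phi> ^ kendall_tau V (relabel \<sigma> W))"
    by (simp add: mallows_Z_def relabel_image_rankings[OF \<sigma> A])
  also have "\<dots> = mallows_Z A \<phi> W"
    by (simp add: mallows_Z_def sum.reindex[OF relabel_inj_on[OF \<sigma>]] KT)
  finally have Z: "mallows_Z A \<phi> (relabel \<sigma> W) = mallows_Z A \<phi> W" .
  show "pmf (map_pmf (relabel \<sigma>) (mallows A \<phi> W)) V' = pmf (mallows A \<phi> (relabel \<sigma> W)) V'"
  proof (cases "V' \<in> rankings A")
    case False
    then show ?thesis
      using relabel_image_rankings[OF \<sigma> A]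
      by (subst pmf_map_outside) (auto simp: set_pmf_mallows[OF A \<phi>] pmf_mallows[OF A \<phi>])
  next
    case True
    then obtain V where V: "V \<in> rankings A" "V' = relabel \<sigma> V"
      using relabel_image_rankings[OF \<sigma> A] by blast
    have "pmf (map_pmf (relabel \<sigma>) (mallows A \<phi> W)) V' = pmf (mallows A \<phi> W) V"
      using V relabel_inj_on[OF \<sigma>] by (simp add: pmf_map_inj set_pmf_mallows[OF A \<phi>])
    then show ?thesis
      using True V by (simp add: pmf_mallows[OF A \<phi>] KT Z)
  qed
qed

lemma mallows_profile_relabel:
  assumes "bij_betw \<sigma> A A" "finite A" "0 < \<phi>" "W \<in> rankings A"
  shows "map_pmf (map (relabel \<sigma>)) (mallows_profile A \<phi> n W) = mallows_profile A \<phi> n (relabel \<sigma> W)"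
  by (simp add: mallows_profile_def map_replicate_pmf mallows_relabel[OF assms])

lemma margin_others_relabel:
  assumes \<sigma>: "bij_betw \<sigma> A A" and a: "a \<in> A" "\<sigma> a = a" and P: "P \<in> profiles A n"
  shows "margin_others A (map (relabel \<sigma>) P) a = margin_others A P a"
proof -
  have inj: "inj_on \<sigma> A" using \<sigma> by (simp add: bij_betw_def)
  have votes: "votes (map (relabel \<sigma>) P) (\<sigma> b) (\<sigma> c) = votes P b c" if "b \<in> A" "c \<in> A" for b c
  proof -
    have "filter (\<lambda>V. prefers (relabel \<sigma> V) (\<sigma> b) (\<sigma> c)) P = filter (\<lambda>V. prefers V b c) P"
      using P that
      by (intro filter_cong refl prefers_relabel_iff[OF inj])
        (auto simp: profiles_def rankings_iff dest!: subsetD)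
    then show ?thesis by (simp add: votes_def filter_map o_def)
  qed
  have "bij_betw \<sigma> (A - {a}) (A - {a})"
    using bij_betw_DiffI[OF \<sigma>, of "{a}" "{a}"] a by (simp add: bij_betw_def)
  then show ?thesis
    unfolding margin_others_def
    by (rule sum.reindex_bij_betw[symmetric, THEN trans, OF _ sum.cong])
      (use a votes[of a] votes[of _ a] in \<open>auto simp: margin_def\<close>)
qed

text \<open>
  Two linear orders on a finite set are isomorphic; an isomorphism preserves the last element.
\<close>

lemma bottom_rankings_conjugate:
  assumes A: "finite A" and a: "a \<in> A"
    and W: "W \<in> bottom_rankings A a" and W': "W' \<in> bottom_rankings A a"
  obtains \<sigma> where "bij_betw \<sigma> A A" "\<sigma> a = a" "relabel \<sigma> W = W'"
proof -
  have well: "well_order_on A U" if "U \<in> bottom_rankings A a" for U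
  proof -
    have "U \<in> rankings A" using that by (simp add: bottom_rankings_def)
    moreover from this have "finite U" using A by (auto simp: rankings_iff intro: finite_subset)
    ultimately show ?thesis by (simp add: rankings_def linear_order_on_well_order_on)
  qed
  obtain \<sigma> where "iso W W' \<sigma>"
    using finite_well_order_on_ordIso[OF A well[OF W] well[OF W']] by (auto simp: ordIso_def)
  then have \<sigma>: "bij_betw \<sigma> A A"
    and ord: "\<And>x y. x \<in> A \<Longrightarrow> y \<in> A \<Longrightarrow> (x, y) \<in> W \<longleftrightarrow> (\<sigma> x, \<sigma> y) \<in> W'"
    using well_order_on_Field[OF well[OF W]] well_order_on_Field[OF well[OF W']]
    by (auto simp: iso_iff2)
  have sub: "W \<subseteq> A \<times> A" "W' \<subseteq> A \<times> A" and anti: "antisym W'"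
    using W W' by (auto simp: bottom_rankings_def rankings_iff)
  have least: "(x, a) \<in> U" if "x \<in> A" "U \<in> bottom_rankings A a" for x U
    using that a by (cases "x = a") (auto simp: bottom_rankings_def rankings_iff prefers_def)
  have im: "\<sigma> ` A = A" using \<sigma> by (simp add: bij_betw_def)
  have "\<sigma> a = a"
  proof -
    obtain x where x: "x \<in> A" "\<sigma> x = a" using im a by (metis imageE)
    then have "(a, \<sigma> a) \<in> W'" using ord[OF x(1) a] least[OF x(1) W] by simp
    moreover have "(\<sigma> a, a) \<in> W'" using least[OF _ W', of "\<sigma> a"] im a by blast
    ultimately show ?thesis using anti by (auto dest: antisymD)
  qed
  moreover have "relabel \<sigma> W = W'"
  proof (intro equalityI subsetI)
    fix z assume "z \<in> relabel \<sigma> W"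
    then show "z \<in> W'" using sub(1) ord by (auto simp: relabel_def)
  next
    fix z assume z: "z \<in> W'"
    then have "z \<in> \<sigma> ` A \<times> \<sigma> ` A" using sub(2) im by auto
    then obtain x y where "x \<in> A" "y \<in> A" "z = (\<sigma> x, \<sigma> y)" by blast
    with z ord show "z \<in> relabel \<sigma> W" by (force simp: relabel_def)
  qed
  ultimately show ?thesis using \<sigma> that by blast
qed

text \<open>
  This symmetry makes every point of the composite null hypothesis least favourable, and so
  reduces the size of the test to its size at one point of choice.
\<close>

lemma size_at_bottom_rankings_const:
  assumes A: "finite A" and a: "a \<in> A" and \<phi>: "0 < \<phi>"
    and W: "W \<in> bottom_rankings A a" and W': "W' \<in> bottom_rankings A a"
  shows "size_at (mallows_profile A \<phi> n) (threshold_test A a K \<Gamma>) W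
       = size_at (mallows_profile A \<phi> n) (threshold_test A a K \<Gamma>) W'"
proof -
  obtain \<sigma> where \<sigma>: "bij_betw \<sigma> A A" "\<sigma> a = a" "relabel \<sigma> W = W'"
    using bottom_rankings_conjugate[OF A a W W'] .
  have WA: "W \<in> rankings A" using W by (simp add: bottom_rankings_def)
  have "size_at (mallows_profile A \<phi> n) (threshold_test A a K \<Gamma>) W'
    = measure_pmf.expectation (mallows_profile A \<phi> n W)
        (\<lambda>P. threshold_test A a K \<Gamma> (map (relabel \<sigma>) P))"
    unfolding size_at_def \<sigma>(3)[symmetric] mallows_profile_relabel[OF \<sigma>(1) A \<phi> WA, symmetric]
    by simp
  also have "\<dots> = size_at (mallows_profile A \<phi> n) (threshold_test A a K \<Gamma>) W"
    unfolding size_at_def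
    by (rule integral_cong_AE)
      (auto simp: AE_measure_pmf_iff set_pmf_mallows_profile[OF A \<phi>] threshold_test_def
         margin_others_relabel[OF \<sigma>(1) a \<sigma>(2)])
  finally show ?thesis by simp
qed

section \<open>Monotone likelihood ratio\<close>

definition move_to_bottom :: "'a set \<Rightarrow> 'a \<Rightarrow> 'a rel \<Rightarrow> 'a rel" where
  "move_to_bottom A a W = {(b, c) \<in> W. b \<noteq> a \<and> c \<noteq> a} \<union> A \<times> {a}"

lemma move_to_bottom_in:
  assumes "W \<in> rankings A" "a \<in> A"
  shows "move_to_bottom A a W \<in> bottom_rankings A a"
  using assms
  by (auto simp: bottom_rankings_def rankings_iff move_to_bottom_def prefers_def antisym_def
      intro!: transI dest: transD)

lemma bottom_rankings_nonempty: "a \<in> A \<Longrightarrow> bottom_rankings A a \<noteq> {}"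
  using rankings_nonempty[of A] move_to_bottom_in by fast

lemma card_image_doubleton: "card ((\<lambda>b. {a, b}) ` B) = card B"
  by (rule card_image) (auto simp: inj_on_def doubleton_eq_iff)

text \<open>
  Disagreements that involve \<open>a\<close> are counted by the other alternative of the pair. In this form
  only the second summand changes when \<open>a\<close> is moved within \<open>W\<close>.
\<close>

lemma kendall_tau_split:
  assumes A: "finite A" and V: "V \<subseteq> A \<times> A"
  shows "kendall_tau V W
    = card {{b, c} | b c. prefers V b c \<and> prefers W c b \<and> b \<noteq> a \<and> c \<noteq> a}
      + card {b \<in> A - {a}. prefers V a b \<and> prefers W b a \<or> prefers V b a \<and> prefers W a b}"
    (is "_ = card ?X + card ?B")
proof -
  have "{{b, c} | b c. prefers V b c \<and> prefers W c b} = ?X \<union> (\<lambda>b. {a, b}) ` ?B"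
  proof (intro equalityI subsetI)
    fix Y assume "Y \<in> {{b, c} | b c. prefers V b c \<and> prefers W c b}"
    then obtain b c where Y: "Y = {b, c}" and bc: "prefers V b c" "prefers W c b" by blast
    have "b \<in> A" "c \<in> A" "b \<noteq> c" using bc(1) V by (auto simp: prefers_def)
    then consider "b = a" "c \<in> ?B" | "c = a" "b \<in> ?B" | "b \<noteq> a" "c \<noteq> a"
      using bc by blast
    then show "Y \<in> ?X \<union> (\<lambda>b. {a, b}) ` ?B"
    proof cases
      case 1 then show ?thesis using Y by blast
    next
      case 2 then show ?thesis using Y by (simp add: image_iff) (metis insert_commute)
    next
      case 3 then show ?thesis using Y bc by blast
    qed
  next
    fix Y assume "Y \<in> ?X \<union> (\<lambda>b. {a, b}) ` ?B"
    then show "Y \<in> {{b, c} | b c. prefers V b c \<and> prefers W c b}"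
    proof
      assume "Y \<in> (\<lambda>b. {a, b}) ` ?B"
      then obtain b where Y: "Y = {a, b}" "Y = {b, a}" and
        b: "prefers V a b \<and> prefers W b a \<or> prefers V b a \<and> prefers W a b" by blast
      from b show ?thesis
      proof
        assume "prefers V a b \<and> prefers W b a"
        with Y(1) show ?thesis by blast
      next
        assume "prefers V b a \<and> prefers W a b"
        with Y(2) show ?thesis by blast
      qed
    qed blast
  qed
  moreover have "?X \<inter> (\<lambda>b. {a, b}) ` ?B = {}"
  proof -
    have "a \<notin> Y" if "Y \<in> ?X" for Y using that by blast
    moreover have "a \<in> Y" if "Y \<in> (\<lambda>b. {a, b}) ` ?B" for Y using that by blast
    ultimately show ?thesis by blast
  qed
  moreover have "finite ?X"
    using V A by (intro finite_subset[of ?X "Pow A"]) (auto simp: prefers_def)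
  ultimately show ?thesis
    using A by (simp add: kendall_tau_def card_Un_disjoint card_image_doubleton)
qed

text \<open>
  The statistic is additive over votes, as the log-likelihood is.
\<close>

lemma margin_others_Cons:
  "margin_others A (V # P) a = margin_others A [V] a + margin_others A P a"
  unfolding margin_others_def sum.distrib[symmetric]
  by (rule sum.cong) (simp_all add: margin_def votes_def)

lemma margin_others_single:
  assumes "finite A"
  shows "margin_others A [V] a
    = int (card {b \<in> A - {a}. prefers V a b}) - int (card {b \<in> A - {a}. prefers V b a})"
proof -
  have "margin_others A [V] a
    = (\<Sum>b\<in>A - {a}. of_bool (prefers V a b) - of_bool (prefers V b a))"
    unfolding margin_others_def by (rule sum.cong) (auto simp: margin_def votes_def)
  then show ?thesis
    using assms by (simp add: sum_subtractf Int_def)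
qed

text \<open>
  The test statistic arises here: pairs that avoid \<open>a\<close> cancel, and each pair \<open>{a, b}\<close>
  is a disagreement with exactly one of the two rankings.
\<close>

lemma kendall_tau_move_to_bottom:
  assumes A: "finite A" and a: "a \<in> A" and V: "V \<in> rankings A" and W: "W \<in> top_rankings A a"
  shows "int (kendall_tau V (move_to_bottom A a W)) = int (kendall_tau V W) + margin_others A [V] a"
proof -
  let ?B = "move_to_bottom A a W"
  have WA: "W \<in> rankings A" using W by (simp add: top_rankings_def)
  have sub: "V \<subseteq> A \<times> A" using V by (simp add: rankings_iff)
  have top: "prefers W a b \<and> \<not> prefers W b a" if "b \<in> A - {a}" for b
    using that W by (auto simp: top_rankings_def rankings_iff prefers_def dest: antisymD)
  have bot: "prefers ?B b a \<and> \<not> prefers ?B a b" if "b \<in> A - {a}" for b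
    using that by (auto simp: move_to_bottom_def prefers_def)
  have rest: "prefers ?B c b \<and> b \<noteq> a \<and> c \<noteq> a \<longleftrightarrow> prefers W c b \<and> b \<noteq> a \<and> c \<noteq> a" for b c
    by (auto simp: move_to_bottom_def prefers_def)
  have "{b \<in> A - {a}. prefers V a b \<and> prefers W b a \<or> prefers V b a \<and> prefers W a b}
      = {b \<in> A - {a}. prefers V b a}"
    using top by blast
  moreover have "{b \<in> A - {a}. prefers V a b \<and> prefers ?B b a \<or> prefers V b a \<and> prefers ?B a b}
      = {b \<in> A - {a}. prefers V a b}"
    using bot by blast
  ultimately show ?thesis
    unfolding kendall_tau_split[OF A sub, of W a] kendall_tau_split[OF A sub, of ?B a]
      margin_others_single[OF A] rest
    by simp
qed

text \<open>
  By independence the ratios of the single votes multiply, so the exponents add up to the margin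
  of the whole profile; the profile enters the ratio through its margin alone.
\<close>

lemma likelihood_ratio:
  assumes A: "finite A" and a: "a \<in> A" and \<phi>: "0 < \<phi>" and W: "W \<in> top_rankings A a"
    and P: "P \<in> profiles A n"
  shows "pmf (mallows_profile A \<phi> n W) P
    = (mallows_Z A \<phi> (move_to_bottom A a W) / mallows_Z A \<phi> W) ^ n
      * \<phi> powr (- real_of_int (margin_others A P a))
      * pmf (mallows_profile A \<phi> n (move_to_bottom A a W)) P"
proof -
  let ?B = "move_to_bottom A a W"
  define c where "c = mallows_Z A \<phi> ?B / mallows_Z A \<phi> W"
  note Z = mallows_Z_pos[OF A \<phi>, of W] mallows_Z_pos[OF A \<phi>, of ?B]
  have vote: "pmf (mallows A \<phi> W) V
      = c * \<phi> powr (- real_of_int (margin_others A [V] a)) * pmf (mallows A \<phi> ?B) V"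
    if V: "V \<in> rankings A" for V
  proof -
    have "real (kendall_tau V W)
        = - real_of_int (margin_others A [V] a) + real (kendall_tau V ?B)"
      using kendall_tau_move_to_bottom[OF A a V W] by linarith
    then have "\<phi> ^ kendall_tau V W
        = \<phi> powr (- real_of_int (margin_others A [V] a)) * \<phi> ^ kendall_tau V ?B"
      using \<phi> by (metis powr_add powr_realpow)
    then show ?thesis using Z V by (simp add: pmf_mallows[OF A \<phi>] c_def)
  qed
  have "prod_list (map (pmf (mallows A \<phi> W)) P)
      = c ^ length P * \<phi> powr (- real_of_int (margin_others A P a))
        * prod_list (map (pmf (mallows A \<phi> ?B)) P)"
    if "set P \<subseteq> rankings A" for P
    using that
  proof (induction P)
    case Nil
    then show ?case using \<phi> by (simp add: margin_others_def margin_def votes_def)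
  next
    case (Cons V P)
    have "\<phi> powr (- real_of_int (margin_others A (V # P) a))
        = \<phi> powr (- real_of_int (margin_others A [V] a)) * \<phi> powr (- real_of_int (margin_others A P a))"
      unfolding margin_others_Cons[of A V P] by (simp flip: powr_add)
    with Cons show ?case by (simp add: vote mult_ac)
  qed
  then show ?thesis
    using P by (auto simp: profiles_def mallows_profile_def pmf_replicate_pmf c_def)
qed

section \<open>The uniformly most powerful test\<close>

theorem theorem3:
  fixes A :: "'a set" and a :: 'a and \<phi> \<alpha> :: real and n :: nat
  assumes "finite A" and "card A \<ge> 2"
    and "0 < \<phi>" and "\<phi> < 1"
    and "n \<ge> 1"
    and "a \<in> A"
    and "0 < \<alpha>" and "\<alpha> < 1"
  shows
    "(\<exists>K \<Gamma>. 0 \<le> \<Gamma> \<and> \<Gamma> \<le> 1 \<and>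
        test_size (mallows_profile A \<phi> n) (bottom_rankings A a) (threshold_test A a K \<Gamma>) = \<alpha>)
     \<and> (\<forall>K \<Gamma>. 0 \<le> \<Gamma> \<and> \<Gamma> \<le> 1 \<and>
          test_size (mallows_profile A \<phi> n) (bottom_rankings A a) (threshold_test A a K \<Gamma>) = \<alpha>
        \<longrightarrow> is_UMP (profiles A n) (mallows_profile A \<phi> n)
              (bottom_rankings A a) (top_rankings A a) \<alpha> (threshold_test A a K \<Gamma>))"
proof -
  note A = \<open>finite A\<close> and a = \<open>a \<in> A\<close> and \<phi> = \<open>0 < \<phi>\<close>
  let ?\<pi> = "mallows_profile A \<phi> n" and ?H0 = "bottom_rankings A a" and ?S = "profiles A n"
  have finS: "finite ?S"
    using finite_lists_length_eq[OF finite_rankings[OF A], of n]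
    by (simp add: profiles_def conj_commute)
  note supp = set_pmf_mallows_profile[OF A \<phi>, of n]
  have size: "test_size ?\<pi> ?H0 (threshold_test A a K \<Gamma>) = size_at ?\<pi> (threshold_test A a K \<Gamma>) W"
    if "W \<in> ?H0" for K \<Gamma> W
  proof -
    have "test_size ?\<pi> ?H0 (threshold_test A a K \<Gamma>)
        = (SUP _\<in>?H0. size_at ?\<pi> (threshold_test A a K \<Gamma>) W)"
      unfolding test_size_def
      by (intro SUP_cong refl) (rule size_at_bottom_rankings_const[OF A a \<phi> _ that])
    also have "\<dots> = size_at ?\<pi> (threshold_test A a K \<Gamma>) W"
      using that by (intro cSUP_const) auto
    finally show ?thesis .
  qed
  have "\<exists>K \<Gamma>. 0 \<le> \<Gamma> \<and> \<Gamma> \<le> 1 \<and> test_size ?\<pi> ?H0 (threshold_test A a K \<Gamma>) = \<alpha>"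
  proof -
    obtain W where W: "W \<in> ?H0" using bottom_rankings_nonempty[OF a] by blast
    have "finite (set_pmf (?\<pi> W))" using finS by (simp add: supp)
    from threshold_attains_level[OF this \<open>0 < \<alpha>\<close> \<open>\<alpha> < 1\<close>,
        of "\<lambda>P. real_of_int (margin_others A P a)"]
    show ?thesis
      unfolding size[OF W] size_at_def threshold_test_def .
  qed
  moreover have "is_UMP ?S ?\<pi> ?H0 (top_rankings A a) \<alpha> (threshold_test A a K \<Gamma>)"
    if \<Gamma>: "0 \<le> \<Gamma>" "\<Gamma> \<le> 1" and \<alpha>: "test_size ?\<pi> ?H0 (threshold_test A a K \<Gamma>) = \<alpha>" for K \<Gamma>
    unfolding is_UMP_def
  proof (intro conjI ballI allI impI)
    obtain b where "b \<in> A" "b \<noteq> a"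
      using \<open>card A \<ge> 2\<close> a A by (metis card_le_Suc0_iff_eq not_less_eq_eq numeral_2_eq_2)
    then show "?H0 \<inter> top_rankings A a = {}"
      by (auto simp: bottom_rankings_def top_rankings_def rankings_iff prefers_def
          dest!: bspec[of _ _ b] dest: antisymD)
    show "is_test ?S (threshold_test A a K \<Gamma>)"
      using \<Gamma> by (simp add: is_test_def threshold_test_def)
    show "test_size ?\<pi> ?H0 (threshold_test A a K \<Gamma>) = \<alpha>" by (fact \<alpha>)
  next
    fix W g
    assume W: "W \<in> top_rankings A a" and "is_test ?S g \<and> test_size ?\<pi> ?H0 g \<le> \<alpha>"
    then have g: "is_test ?S g" "test_size ?\<pi> ?H0 g \<le> \<alpha>" by auto
    define B where "B = move_to_bottom A a W"
    have B: "B \<in> ?H0" using W move_to_bottom_in a by (auto simp: B_def top_rankings_def)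
    define c where "c = (mallows_Z A \<phi> B / mallows_Z A \<phi> W) ^ n"
    have c: "c > 0" using mallows_Z_pos[OF A \<phi>] by (simp add: c_def)
    have LR: "pmf (?\<pi> W) P = c * \<phi> powr (- real_of_int (margin_others A P a)) * pmf (?\<pi> B) P"
      if "P \<in> ?S" for P
      using likelihood_ratio[OF A a \<phi> W that] by (simp add: B_def c_def)
    have pos: "pmf (?\<pi> B) P > 0" if "P \<in> ?S" for P
      using that supp[of B] by (simp add: pmf_positive)
    \<comment> \<open>Comparing the likelihood ratio with \<open>c * \<phi> powr (- K)\<close> is comparing the margin with \<open>K\<close>.\<close>
    have mono: "\<phi> powr (- x) < \<phi> powr (- y) \<longleftrightarrow> x < y" for x y
      using \<phi> \<open>\<phi> < 1\<close> by (smt (verit) powr_less_mono')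
    \<comment> \<open>The size of \<open>g\<close> may vary over the null hypothesis; only its value at \<open>B\<close> matters.\<close>
    have "size_at ?\<pi> g B \<le> test_size ?\<pi> ?H0 g"
      unfolding test_size_def
      using finite_rankings[OF A] B
      by (intro cSUP_upper bdd_above_finite finite_imageI) (auto simp: bottom_rankings_def)
    also have "\<dots> \<le> size_at ?\<pi> (threshold_test A a K \<Gamma>) B"
      using g(2) \<alpha> size[OF B] by simp
    finally have level: "size_at ?\<pi> g B \<le> size_at ?\<pi> (threshold_test A a K \<Gamma>) B" .
    have "measure_pmf.expectation (?\<pi> W) g \<le> measure_pmf.expectation (?\<pi> W) (threshold_test A a K \<Gamma>)"
    proof (rule neyman_pearson[OF finS])
      show "set_pmf (?\<pi> B) \<subseteq> ?S" "set_pmf (?\<pi> W) \<subseteq> ?S" by (simp_all add: supp)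
      show "0 \<le> c * \<phi> powr (- K)" using c by simp
      fix P assume P: "P \<in> ?S"
      show "threshold_test A a K \<Gamma> P = 1" if "c * \<phi> powr (- K) * pmf (?\<pi> B) P < pmf (?\<pi> W) P"
        using that c pos[OF P] by (simp add: LR[OF P] mono threshold_test_def)
      show "threshold_test A a K \<Gamma> P = 0" if "pmf (?\<pi> W) P < c * \<phi> powr (- K) * pmf (?\<pi> B) P"
        using that c pos[OF P] by (simp add: LR[OF P] mono threshold_test_def)
    qed (use g(1) level in \<open>simp_all add: size_at_def\<close>)
    then show "power_at ?\<pi> g W \<le> power_at ?\<pi> (threshold_test A a K \<Gamma>) W"
      by (simp add: power_at_def)
  qed
  ultimately show ?thesis by blast
qed

end
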